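(* Let $G$ be an acyclic connected undirected graph (a tree) with $n$ nodes, $m=n-1$ edges and incidence matrix $B\in\mathbb R^{n\times(n-1)}$. Let $\Omega=\{\boldsymbol\omega\in\mathbb R^n: C\boldsymbol\omega\le\mathbf d\}$ be a polyhedral uncertainty set with given $C\in\mathbb R^{p\times n}$, $\mathbf d\in\mathbb R^p$, let $f_{\mathcal E}:\mathbb R_+^{m}\to\mathbb R$ be a convex function, let $F_{\mathbf w}\subset\mathbb R_+^{m}$ be a closed convex set with $\lambda_2(L(\mathbf w))>0$ for all $\mathbf w\in F_{\mathbf w}$, and let $\gamma_d\in[0,\pi/2)$. Then the robust weight design problem $$\underset{\mathbf w\in F_{\mathbf w}}{\text{minimize}}\ f_{\mathcal E}(\mathbf w)\quad\text{s.t.}\quad \max_{\boldsymbol\omega\in\Omega}\|B^\top L(\mathbf w)^\dagger\boldsymbol\omega\|_\infty\le\sin(\gamma_d)$$ is equivalent to the following convex problem, $$\underset{\mathbf w\in F_{\mathbf w}}{\text{minimize}}\ f_{\mathcal E}(\mathbf w)\quad\text{s.t.}\quad \mathbf w\ge\underline{\mathbf w}\,\sin(\gamma_d)^{-1},$$ where each component of $\underline{\mathbf w}=[\underline w_1,\dots,\underline w_{n-1}]^\top\in\mathbb R_{++}^{n-1}$ is the solution to the following linear program, $$\underline w_e=\max_{\boldsymbol\omega\in\Omega}\big|\mathbf u_e^\top B^\top(BB^\top)^\dagger\boldsymbol\omega\big|,\quad e\in\{1,\dots,n-1\},$$ and $\mathbf u_e\in\mathbb R^m$ is the $e$-th standard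 unit basis vector.
   Context: The incidence matrix $B$ has, for each edge $e=\{i,j\}$, a column $\mathbf b_e\in\mathbb R^n$ with $b_{e,i}=1$, $b_{e,j}=-1$ (or the opposite signs; the orientation is arbitrary) and all other entries zero. For an edge-weight vector $\mathbf w$, the weighted Laplacian is $L(\mathbf w)=B\,\mathrm{diag}(\mathbf w)B^\top$; $\lambda_2(L(\mathbf w))$ denotes its second smallest eigenvalue; $(\cdot)^\dagger$ is the Moore-Penrose pseudoinverse. $\sin(\gamma_d)^{-1}$ denotes the reciprocal $1/\sin(\gamma_d)$. $\|\mathbf x\|_\infty=\max_i|x_i|$, and inequalities between vectors are componentwise. $\mathbb R_+$ and $\mathbb R_{++}$ are the sets of nonnegative and strictly positive reals. The set $\Omega$ contains the possible values of the vector $\boldsymbol\omega$ of natural frequencies of a network of coupled oscillators, and $\gamma_d$ is the desired level of phase cohesiveness. *)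

theory Defs
  imports "HOL-Analysis.Analysis" "HOL-Library.Multiset" "HOL-Library.Extended_Real"
begin

(* A finite simple undirected graph on the vertex type 'n is given by its set of edges,
   each edge being a set of two distinct vertices. *)

definition simple_graph :: "'n set set \<Rightarrow> bool" where
  "simple_graph E \<longleftrightarrow> (\<forall>e\<in>E. card e = 2)"

definition walk :: "'n set set \<Rightarrow> 'n list \<Rightarrow> bool" where
  "walk E xs \<longleftrightarrow> xs \<noteq> [] \<and> successively (\<lambda>u v. {u, v} \<in> E) xs"

definition connected_graph :: "'n set set \<Rightarrow> bool" where
  "connected_graph E \<longleftrightarrow> (\<forall>u v. \<exists>xs. walk E xs \<and> hd xs = u \<and> last xs = v)"

definition graph_cycle :: "'n set set \<Rightarrow> 'n list \<Rightarrow> bool" where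
  "graph_cycle E xs \<longleftrightarrow>
     length xs \<ge> 3 \<and> distinct xs \<and> walk E xs \<and> {last xs, hd xs} \<in> E"

definition acyclic_graph :: "'n set set \<Rightarrow> bool" where
  "acyclic_graph E \<longleftrightarrow> (\<nexists>xs. graph_cycle E xs)"

definition tree_graph :: "'n set set \<Rightarrow> bool" where
  "tree_graph E \<longleftrightarrow> simple_graph E \<and> connected_graph E \<and> acyclic_graph E"

(* The function ends enumerates the edges by the index type 'm. The choice of i and j,
   i.e. the orientation, is free for each edge separately. *)
definition incidence_matrix :: "('m::finite \<Rightarrow> 'n::finite set) \<Rightarrow> real^'m^'n \<Rightarrow> bool" where
  "incidence_matrix ends B \<longleftrightarrow>
     (\<forall>e. \<exists>i j. i \<noteq> j \<and> ends e = {i, j} \<and> B $ i $ e = 1 \<and> B $ j $ e = -1 \<and>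
        (\<forall>k. k \<notin> {i, j} \<longrightarrow> B $ k $ e = 0))"

definition diag_matrix :: "real^'m \<Rightarrow> real^'m^'m" where
  "diag_matrix w = (\<chi> i j. if i = j then w $ i else 0)"

definition weighted_laplacian :: "real^'m^'n \<Rightarrow> real^'m \<Rightarrow> real^'n^'n" where
  "weighted_laplacian B w = B ** diag_matrix w ** transpose B"

definition eigenvalues :: "real^'n^'n \<Rightarrow> real set" where
  "eigenvalues A = {\<mu>. \<exists>x. x \<noteq> 0 \<and> A *v x = \<mu> *\<^sub>R x}"

definition eigenspace :: "real^'n^'n \<Rightarrow> real \<Rightarrow> (real^'n) set" where
  "eigenspace A \<mu> = {x. A *v x = \<mu> *\<^sub>R x}"

(* Eigenvalues in increasing order, repeated according to multiplicity. Used for symmetric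
   matrices only, for which geometric and algebraic multiplicities coincide. *)
definition sorted_eigenvalues :: "real^'n^'n \<Rightarrow> real list" where
  "sorted_eigenvalues A =
     sorted_list_of_multiset (\<Sum>\<mu>\<in>eigenvalues A. replicate_mset (dim (eigenspace A \<mu>)) \<mu>)"

definition lambda2 :: "real^'n^'n \<Rightarrow> real" where
  "lambda2 A = sorted_eigenvalues A ! 1"

definition is_pinv :: "real^'n^'m \<Rightarrow> real^'m^'n \<Rightarrow> bool" where
  "is_pinv A X \<longleftrightarrow> A ** X ** A = A \<and> X ** A ** X = X \<and>
     transpose (A ** X) = A ** X \<and> transpose (X ** A) = X ** A"

definition pinv :: "real^'n^'m \<Rightarrow> real^'m^'n" where
  "pinv A = (THE X. is_pinv A X)"

definition is_maximum :: "('a \<Rightarrow> real) \<Rightarrow> 'a set \<Rightarrow> real \<Rightarrow> bool" where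
  "is_maximum g S M \<longleftrightarrow> (\<exists>x\<in>S. g x = M) \<and> (\<forall>x\<in>S. g x \<le> M)"

definition polyhedron_of :: "real^'n^'p \<Rightarrow> real^'p \<Rightarrow> (real^'n) set" where
  "polyhedron_of C d = {\<omega>. C *v \<omega> \<le> d}"

definition robust_feasible ::
  "real^'m^'n \<Rightarrow> (real^'n) set \<Rightarrow> (real^'m) set \<Rightarrow> real \<Rightarrow> (real^'m) set" where
  "robust_feasible B \<Omega> F \<gamma> =
     {w \<in> F. \<exists>M. is_maximum
                  (\<lambda>\<omega>. infnorm ((transpose B ** pinv (weighted_laplacian B w)) *v \<omega>)) \<Omega> M
                \<and> M \<le> sin \<gamma>}"

(* The constraint is stated in the extended reals, where inverse 0 is infinity, so that for
   \<gamma> = 0 and a positive threshold vector it is unsatisfiable (in type real, inverse 0 = 0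
   would make it vacuous). *)
definition threshold_feasible ::
  "real^'m \<Rightarrow> (real^'m) set \<Rightarrow> real \<Rightarrow> (real^'m) set" where
  "threshold_feasible wlow F \<gamma> =
     {w \<in> F. \<forall>e. ereal (w $ e) \<ge> ereal (wlow $ e) * inverse (ereal (sin \<gamma>))}"

definition minimizers :: "('a \<Rightarrow> real) \<Rightarrow> 'a set \<Rightarrow> 'a set" where
  "minimizers f S = {x \<in> S. \<forall>y\<in>S. f x \<le> f y}"

definition optimal_value :: "('a \<Rightarrow> real) \<Rightarrow> 'a set \<Rightarrow> ereal" where
  "optimal_value f S = (INF x\<in>S. ereal (f x))"

end

theory Submission
  imports Defs
begin

text \<open>
  A connected graph with \<open>n - 1\<close> edges has an incidence matrix \<open>B\<close> of full column rank, hence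
  \<open>P = B\<^sup>\<dagger>\<close> is a left inverse of \<open>B\<close>. With \<open>W = diag w\<close> invertible, the pseudoinverse of
  \<open>L(w) = B W B\<^sup>T\<close> is \<open>P\<^sup>T W\<^sup>-\<^sup>1 P\<close>, and therefore \<open>B\<^sup>T L(w)\<^sup>\<dagger> = W\<^sup>-\<^sup>1 P\<close>, which for unit weights
  is \<open>B\<^sup>T (B B\<^sup>T)\<^sup>\<dagger> = P\<close>. So the edge coordinates decouple and the worst case of the \<open>e\<close>-th one is
  \<open>wlow\<^sub>e / w\<^sub>e\<close>. Weights in \<open>F\<close> are strictly positive because a zero weight
  disconnects the tree and forces \<open>\<lambda>\<^sub>2 = 0\<close>.
\<close>

section \<open>Pseudoinverses of matrices and of the weighted Laplacian\<close>

text \<open>Penrose's argument: \<open>A ** X\<close> and \<open>A ** Y\<close> are symmetric, so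
  transposing \<open>A ** X = (A ** Y) ** (A ** X)\<close> swaps the factors and the product
  collapses to \<open>A ** Y\<close>; likewise on the other side. This makes the \<open>THE\<close>
  in \<open>pinv\<close> meaningful.\<close>

lemma is_pinv_unique:
  fixes A :: "real^'n^'m"
  assumes X: "is_pinv A X" and Y: "is_pinv A Y"
  shows "X = Y"
proof -
  note X' = X[unfolded is_pinv_def] and Y' = Y[unfolded is_pinv_def]
  have "A ** X = (A ** Y ** A) ** X" using Y' by simp
  also have "\<dots> = (A ** Y) ** (A ** X)" by (simp add: matrix_mul_assoc)
  also have "\<dots> = transpose ((A ** X) ** (A ** Y))"
    using X' Y' by (simp add: matrix_transpose_mul)
  also have "(A ** X) ** (A ** Y) = A ** Y" using X' by (simp add: matrix_mul_assoc)
  finally have AX: "A ** X = A ** Y" using Y' by simp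
  have "X ** A = X ** (A ** Y ** A)" using Y' by simp
  also have "\<dots> = (X ** A) ** (Y ** A)" by (simp add: matrix_mul_assoc)
  also have "\<dots> = transpose ((Y ** A) ** (X ** A))"
    using X' Y' by (simp add: matrix_transpose_mul)
  also have "(Y ** A) ** (X ** A) = Y ** A" using X' by (metis matrix_mul_assoc)
  finally have XA: "X ** A = Y ** A" using Y' by simp
  have "X = X ** (A ** X)" using X' by (simp add: matrix_mul_assoc)
  also have "\<dots> = (X ** A) ** Y" unfolding AX by (simp add: matrix_mul_assoc)
  also have "\<dots> = Y" unfolding XA using Y' by simp
  finally show ?thesis .
qed

lemma pinv_eqI: "is_pinv A X \<Longrightarrow> pinv A = X"
  unfolding pinv_def by (rule the_equality) (auto intro: is_pinv_unique)

lemma inner_transpose_mul_vec: "y \<bullet> (transpose A *v x) = (A *v y) \<bullet> x"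
  for A :: "real^'m^'n"
  by (metis dot_lmul_matrix inner_commute transpose_matrix_vector)

lemma diag_matrix_mul_vec: "diag_matrix w *v x = (\<chi> e. w $ e * x $ e)"
  by (simp add: diag_matrix_def matrix_vector_mult_def vec_eq_iff mult_delta_left)

lemma transpose_diag_matrix [simp]: "transpose (diag_matrix w) = diag_matrix w"
  by (simp add: diag_matrix_def transpose_def vec_eq_iff)

lemma diag_matrix_inverse:
  fixes w :: "real^'m"
  assumes "\<And>e. w $ e \<noteq> 0"
  shows "diag_matrix w ** diag_matrix (\<chi> e. inverse (w $ e)) = mat 1"
    and "diag_matrix (\<chi> e. inverse (w $ e)) ** diag_matrix w = mat 1"
  using assms by (simp_all add: matrix_eq diag_matrix_mul_vec vec_eq_iff flip: matrix_vector_mul_assoc)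

lemma diag_matrix_1: "diag_matrix (\<chi> e. 1) = mat 1"
  by (simp add: diag_matrix_def mat_def vec_eq_iff)

text \<open>A left inverse of \<open>B\<close> with \<open>B ** P\<close> symmetric is the pseudoinverse of \<open>B\<close>.\<close>

lemma injective_symmetric_left_inverse:
  fixes B :: "real^'m^'n"
  assumes "inj ((*v) B)"
  obtains P where "P ** B = mat 1" "transpose (B ** P) = B ** P"
proof -
  \<comment> \<open>The Gram matrix is injective because \<open>x \<bullet> (G *v x)\<close> is the
    squared norm of \<open>B *v x\<close>. With \<open>H\<close> its inverse, \<open>P\<close> is
    chosen as \<open>H ** transpose B\<close>.\<close>
  define G where "G = transpose B ** B"
  have "inj ((*v) G)"
  proof (rule injI)
    fix x y assume "G *v x = G *v y"
    then have "G *v (x - y) = 0" by (simp add: matrix_vector_mult_diff_distrib)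
    then have "(x - y) \<bullet> (transpose B *v (B *v (x - y))) = 0"
      by (simp add: G_def matrix_vector_mul_assoc)
    then have "(B *v (x - y)) \<bullet> (B *v (x - y)) = 0" by (simp only: inner_transpose_mul_vec)
    then have "B *v x = B *v y" by (simp add: matrix_vector_mult_diff_distrib)
    with assms show "x = y" by (rule injD)
  qed
  then obtain H where H: "H ** G = mat 1"
    using matrix_left_invertible_injective by blast
  then have GH: "G ** H = mat 1" by (simp add: matrix_left_right_inverse)
  have "transpose G = G" by (simp add: G_def matrix_transpose_mul)
  then have "transpose H ** G = mat 1"
    by (metis GH matrix_transpose_mul transpose_mat)
  then have "transpose H = H" by (metis GH matrix_mul_assoc matrix_mul_lid matrix_mul_rid)
  show ?thesis
  proof
    show "(H ** transpose B) ** B = mat 1" using H by (simp add: G_def matrix_mul_assoc)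
    show "transpose (B ** (H ** transpose B)) = B ** (H ** transpose B)"
      using \<open>transpose H = H\<close> by (simp add: matrix_transpose_mul matrix_mul_assoc)
  qed
qed

text \<open>The candidate \<open>X\<close> satisfies the Penrose equations because its products with
  the Laplacian, in either order, are both \<open>B ** P\<close>, the orthogonal projection onto the
  column space of \<open>B\<close>.\<close>

lemma transpose_mul_pinv_laplacian:
  fixes B :: "real^'m^'n"
  assumes PB: "P ** B = mat 1" and sym: "transpose (B ** P) = B ** P"
    and w: "\<And>e. w $ e \<noteq> 0"
  shows "transpose B ** pinv (weighted_laplacian B w) = diag_matrix (\<chi> e. inverse (w $ e)) ** P"
proof -
  define V where "V = diag_matrix (\<chi> e. inverse (w $ e))"
  define W where "W = diag_matrix w"
  define X where "X = transpose P ** V ** P"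
  have WV: "W ** V = mat 1" "V ** W = mat 1"
    using diag_matrix_inverse[of w] w by (auto simp: W_def V_def)
  have BP: "transpose B ** transpose P = mat 1"
    using PB by (metis matrix_transpose_mul transpose_mat)
  have PtBt: "transpose P ** transpose B = B ** P"
    using sym by (simp add: matrix_transpose_mul)
  have L: "weighted_laplacian B w = B ** W ** transpose B"
    by (simp add: weighted_laplacian_def W_def)
  have BX: "transpose B ** X = V ** P"
    unfolding X_def by (metis BP matrix_mul_assoc matrix_mul_lid)
  have LX: "(B ** W ** transpose B) ** X = B ** P"
    by (metis BX WV(1) matrix_mul_assoc matrix_mul_lid)
  have XL: "X ** (B ** W ** transpose B) = B ** P"
    unfolding X_def by (metis PB WV(2) PtBt matrix_mul_assoc matrix_mul_rid)
  have "is_pinv (B ** W ** transpose B) X"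
    unfolding is_pinv_def LX XL sym
  proof (intro conjI refl)
    show "B ** P ** (B ** W ** transpose B) = B ** W ** transpose B"
      by (metis PB matrix_mul_assoc matrix_mul_rid)
    show "B ** P ** X = X"
      unfolding X_def PtBt[symmetric] by (metis BP matrix_mul_assoc matrix_mul_rid)
  qed
  then show ?thesis using BX pinv_eqI by (metis L V_def)
qed


section \<open>Spectrum of the weighted Laplacian\<close>

lemma laplacian_mul_vec:
  "weighted_laplacian B w *v x = B *v (\<chi> e. w $ e * (transpose B *v x) $ e)"
  by (simp add: weighted_laplacian_def diag_matrix_mul_vec flip: matrix_vector_mul_assoc)

lemma transpose_laplacian: "transpose (weighted_laplacian B w) = weighted_laplacian B w"
  by (simp add: weighted_laplacian_def matrix_transpose_mul matrix_mul_assoc)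

text \<open>The quadratic form is the weighted sum of the squared entries of
  \<open>transpose B *v x\<close>.\<close>

lemma laplacian_nonneg:
  assumes "\<And>e. 0 \<le> w $ e"
  shows "0 \<le> x \<bullet> (weighted_laplacian B w *v x)"
proof -
  have "x \<bullet> (weighted_laplacian B w *v x)
      = (transpose B *v x) \<bullet> (\<chi> e. w $ e * (transpose B *v x) $ e)"
    unfolding laplacian_mul_vec
    using inner_transpose_mul_vec[of x "transpose B"] by simp
  also have "\<dots> \<ge> 0"
    using assms by (auto simp: inner_vec_def intro!: sum_nonneg)
      (metis mult.left_commute mult_nonneg_nonneg zero_le_square)
  finally show ?thesis .
qed

text \<open>Eigenvectors for distinct eigenvalues are orthogonal, hence independent. Finiteness
  matters because the sum in \<open>sorted_eigenvalues\<close> would default to the empty multiset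
  over an infinite set.\<close>

lemma finite_eigenvalues_symmetric:
  fixes A :: "real^'n^'n"
  assumes "transpose A = A"
  shows "finite (eigenvalues A)"
proof -
  have "\<forall>\<mu>\<in>eigenvalues A. \<exists>x. x \<noteq> 0 \<and> A *v x = \<mu> *\<^sub>R x"
    by (auto simp: eigenvalues_def)
  then obtain v where v: "\<And>\<mu>. \<mu> \<in> eigenvalues A \<Longrightarrow> v \<mu> \<noteq> 0 \<and> A *v v \<mu> = \<mu> *\<^sub>R v \<mu>"
    by metis
  have inj: "inj_on v (eigenvalues A)"
    by (rule inj_onI) (metis v scaleR_cancel_right)
  have orth: "v \<mu> \<bullet> v \<nu> = 0" if "\<mu> \<in> eigenvalues A" "\<nu> \<in> eigenvalues A" "\<mu> \<noteq> \<nu>" for \<mu> \<nu>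
  proof -
    have "\<nu> * (v \<mu> \<bullet> v \<nu>) = v \<mu> \<bullet> (transpose A *v v \<nu>)" using v that assms by simp
    also have "\<dots> = \<mu> * (v \<mu> \<bullet> v \<nu>)" unfolding inner_transpose_mul_vec using v that by simp
    finally show ?thesis using that by simp
  qed
  have "independent (v ` eigenvalues A)"
    by (rule pairwise_orthogonal_independent)
      (use orth v in \<open>auto simp: pairwise_def orthogonal_def\<close>)
  then have "finite (v ` eigenvalues A)" by (rule independent_imp_finite)
  then show ?thesis using inj by (rule finite_imageD)
qed

text \<open>Zero has multiplicity at least two and no eigenvalue is negative, so the sorted list
  begins with two zeros.\<close>

lemma lambda2_eq_0:
  fixes A :: "real^'n^'n"
  assumes sym: "transpose A = A" and psd: "\<And>x. 0 \<le> x \<bullet> (A *v x)"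
    and ker: "2 \<le> dim {x. A *v x = 0}"
  shows "lambda2 A = 0"
proof -
  define M where "M = (\<Sum>\<mu>\<in>eigenvalues A. replicate_mset (dim (eigenspace A \<mu>)) \<mu>)"
  have fin: "finite (eigenvalues A)" by (rule finite_eigenvalues_symmetric[OF sym])
  have nonneg: "\<mu> \<ge> 0" if "\<mu> \<in># M" for \<mu>
  proof -
    have "\<mu> \<in> eigenvalues A"
      using that fin by (auto simp: M_def set_mset_sum split: if_splits)
    then obtain x where x: "x \<noteq> 0" "A *v x = \<mu> *\<^sub>R x" by (auto simp: eigenvalues_def)
    then have "0 \<le> \<mu> * (x \<bullet> x)" using psd[of x] by simp
    moreover have "0 < x \<bullet> x" using x by simp
    ultimately show ?thesis by (simp add: zero_le_mult_iff)
  qed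
  have "\<not> {x. A *v x = 0} \<subseteq> {0}" using ker
    by (metis dim_eq_0 not_numeral_le_zero)
  then have "0 \<in> eigenvalues A" by (auto simp: eigenvalues_def)
  then have "count M 0 = dim (eigenspace A 0)"
    using fin by (simp add: M_def count_sum if_distrib sum.delta cong: if_cong)
  then have "count M 0 \<ge> 2" using ker by (simp add: eigenspace_def)
  then have "{#0, 0#} \<subseteq># M" by (auto simp: subseteq_mset_def)
  then obtain N where N: "M = add_mset 0 (add_mset 0 N)"
    by (metis add_mset_add_single mset_subset_eq_exists_conv union_mset_add_mset_left add_0)
  then have "sorted_list_of_multiset M = 0 # 0 # sorted_list_of_multiset N"
    using nonneg by (simp add: insort_is_Cons)
  then show ?thesis by (simp add: lambda2_def sorted_eigenvalues_def M_def)
qed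

section \<open>Kernel and rank of the incidence matrix\<close>

lemma transpose_mul_vec_nth: "(transpose B *v x) $ e = column e B \<bullet> x"
  for B :: "real^'m^'n"
  by (simp add: matrix_vector_mult_def transpose_def column_def inner_vec_def)

text \<open>Rank-nullity for the transpose of the submatrix with columns \<open>S\<close>. All
  columns give the rank of \<open>B\<close>; omitting one edge gives the kernel for a zero
  weight.\<close>

lemma dim_orthogonal_columns:
  fixes B :: "real^'m^'n"
  shows "dim {x. \<forall>e\<in>S. column e B \<bullet> x = 0} + dim ((\<lambda>e. column e B) ` S) = CARD('n)"
proof -
  let ?V = "span ((\<lambda>e. column e B) ` S)"
  have "{x. \<forall>e\<in>S. column e B \<bullet> x = 0} = {x \<in> UNIV. \<forall>v\<in>?V. orthogonal v x}"
    by (auto simp: orthogonal_def intro: span_base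
        dest: orthogonal_to_span[of _ "(\<lambda>e. column e B) ` S", unfolded orthogonal_def]
        simp: inner_commute)
  with dim_subspace_orthogonal_to_vectors[of ?V UNIV] show ?thesis
    by simp
qed

text \<open>Each column of \<open>B\<close> tests the difference of \<open>x\<close> across one
  edge, and equality spreads along walks.\<close>

lemma incidence_kernel_constant:
  assumes inc: "incidence_matrix ends B" and surj: "range ends = E"
    and conn: "connected_graph E" and x: "transpose B *v x = 0"
  shows "x $ u = x $ v"
proof -
  have edge: "x $ a = x $ b" if "{a, b} \<in> E" for a b
  proof -
    have "{a, b} \<in> range ends" using that surj by simp
    then obtain e where e: "ends e = {a, b}" by (metis rangeE)
    obtain i j where ij: "i \<noteq> j" "ends e = {i, j}" "B $ i $ e = 1" "B $ j $ e = -1"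
      "\<And>k. k \<notin> {i, j} \<Longrightarrow> B $ k $ e = 0"
      using inc[unfolded incidence_matrix_def, rule_format, of e] by blast
    have "0 = column e B \<bullet> x" using x by (metis transpose_mul_vec_nth zero_index)
    also have "\<dots> = (\<Sum>k\<in>UNIV. B $ k $ e * x $ k)" by (simp add: inner_vec_def column_def)
    also have "\<dots> = (\<Sum>k\<in>{i, j}. B $ k $ e * x $ k)"
      using ij(5) by (intro sum.mono_neutral_right) auto
    also have "\<dots> = x $ i - x $ j" using ij by simp
    finally show ?thesis using e ij(2) by (auto simp: doubleton_eq_iff)
  qed
  have walk: "x $ hd xs = x $ last xs" if "walk E xs" for xs
    using that
  proof (induction xs rule: induct_list012)
    case (3 a b xs)
    then show ?case using edge[of a b] by (simp add: walk_def)
  qed (auto simp: walk_def)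
  show ?thesis using conn walk unfolding connected_graph_def by metis
qed

text \<open>The kernel of \<open>transpose B\<close> is at most the line of constant vectors, so the
  rank of \<open>B\<close> is at least \<open>CARD('n) - 1\<close>, its number of columns.\<close>

lemma incidence_injective:
  fixes B :: "real^'m^'n"
  assumes "incidence_matrix ends B" "range ends = E" "connected_graph E"
    and card: "CARD('m) = CARD('n) - 1"
  shows "inj ((*v) B)"
proof -
  have "{x. \<forall>e\<in>UNIV. column e B \<bullet> x = 0} \<subseteq> span {\<chi> i. 1}"
  proof
    fix x assume "x \<in> {x. \<forall>e\<in>UNIV. column e B \<bullet> x = 0}"
    then have "transpose B *v x = 0" 
      by (simp add: vec_eq_iff transpose_mul_vec_nth del: transpose_matrix_vector)
    then have "x $ u = x $ v" for u v using incidence_kernel_constant assms by blast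
    \<comment> \<open>All coordinates agree, so \<open>undefined\<close> serves as an arbitrary
      vertex.\<close>
    then have "x = (x $ undefined) *\<^sub>R (\<chi> i. 1)" by (simp add: vec_eq_iff)
    then show "x \<in> span {\<chi> i. 1}" by (metis span_base span_scale singletonI)
  qed
  then have "dim {x. \<forall>e\<in>UNIV. column e B \<bullet> x = 0} \<le> card {(\<chi> i. 1) :: real^'n}"
    by (intro dim_le_card) auto
  then have "dim (columns B) \<ge> CARD('n) - 1"
    using dim_orthogonal_columns[where B = B and S = UNIV]
    by (simp add: columns_def full_SetCompr_eq)
  then have "rank B = CARD('m)"
    using card rank_bound[of B] by (simp add: column_rank_def)
  then show ?thesis by (simp add: full_rank_injective)
qed

text \<open>With one weight zero, only \<open>n - 2\<close> columns of \<open>B\<close> contribute, so the kernel is at least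
  two-dimensional.\<close>

lemma lambda2_laplacian_zero_weight:
  fixes B :: "real^'m^'n"
  assumes card: "CARD('m) = CARD('n) - 1"
    and w: "\<And>e. 0 \<le> w $ e" and e: "w $ e = 0"
  shows "lambda2 (weighted_laplacian B w) = 0"
proof (rule lambda2_eq_0)
  have "dim ((\<lambda>e. column e B) ` (- {e})) \<le> CARD('m) - 1"
    by (rule order_trans[OF dim_le_card[OF span_superset]])
      (auto intro: order_trans[OF card_image_le] simp: Compl_eq_Diff_UNIV)
  \<comment> \<open>Having at least one edge makes both truncated subtractions,
    \<open>CARD('m) - 1\<close> and \<open>CARD('n) - 1\<close>, exact.\<close>
  moreover have "0 < CARD('m)" by simp
  ultimately have "2 \<le> dim {x. \<forall>e'\<in>- {e}. column e' B \<bullet> x = 0}"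
    using dim_orthogonal_columns[of "- {e}" B] card by linarith
  also have "{x. \<forall>e'\<in>- {e}. column e' B \<bullet> x = 0} \<subseteq> {x. weighted_laplacian B w *v x = 0}"
  proof safe
    fix x assume "\<forall>e'\<in>- {e}. column e' B \<bullet> x = 0"
    then have "(\<chi> e. w $ e * (transpose B *v x) $ e) = 0"
      using e by (auto simp: vec_eq_iff transpose_mul_vec_nth simp del: transpose_matrix_vector)
    then show "weighted_laplacian B w *v x = 0" by (simp add: laplacian_mul_vec)
  qed
  then have "dim {x. \<forall>e'\<in>- {e}. column e' B \<bullet> x = 0} \<le> dim {x. weighted_laplacian B w *v x = 0}"
    by (rule dim_subset)
  finally show "2 \<le> dim {x. weighted_laplacian B w *v x = 0}" .
qed (use w in \<open>auto simp: transpose_laplacian laplacian_nonneg\<close>)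

section \<open>Worst cases over the uncertainty set\<close>

lemma infnorm_le_iff_cart: "infnorm x \<le> r \<longleftrightarrow> (\<forall>e. \<bar>x $ e\<bar> \<le> r)" for x :: "real^'m"
  using component_le_infnorm_cart[of x]
  by (auto intro: order_trans simp: infnorm_cart full_SetCompr_eq intro!: cSup_least)

text \<open>The maxima over edges and over \<open>S\<close> commute, so the worst case is the
  largest ratio \<open>wlow $ e / w $ e\<close>. Since \<open>S\<close> may be unbounded, attainment
  is derived from that of the edgewise maxima.\<close>

lemma robust_max_le_iff:
  fixes Q :: "real^'n \<Rightarrow> real^'m" and w wlow :: "real^'m"
  assumes w: "\<And>e. 0 < w $ e"
    and low: "\<And>e. is_maximum (\<lambda>\<omega>. \<bar>Q \<omega> $ e\<bar>) S (wlow $ e)"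
  shows "(\<exists>M. is_maximum (\<lambda>\<omega>. infnorm (\<chi> e. inverse (w $ e) * Q \<omega> $ e)) S M \<and> M \<le> r)
     \<longleftrightarrow> (\<forall>e. wlow $ e \<le> w $ e * r)" (is "?L \<longleftrightarrow> ?R")
proof -
  let ?g = "\<lambda>\<omega>. infnorm (\<chi> e. inverse (w $ e) * Q \<omega> $ e)"
  have g_le: "?g \<omega> \<le> t \<longleftrightarrow> (\<forall>e. \<bar>Q \<omega> $ e\<bar> \<le> w $ e * t)" for \<omega> t
    using w by (simp add: infnorm_le_iff_cart abs_mult field_simps abs_of_pos)
  have all_le: "(\<forall>\<omega>\<in>S. ?g \<omega> \<le> t) \<longleftrightarrow> (\<forall>e. wlow $ e \<le> w $ e * t)" for t
  proof -
    have "(\<forall>\<omega>\<in>S. \<bar>Q \<omega> $ e\<bar> \<le> b) \<longleftrightarrow> wlow $ e \<le> b" for e b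
      using low[of e] unfolding is_maximum_def by force
    then show ?thesis unfolding g_le by blast
  qed
  define M where "M = Max (range (\<lambda>e. wlow $ e / w $ e))"
  have le_M: "wlow $ e / w $ e \<le> M" for e unfolding M_def by (intro Max_ge) auto
  have "M \<in> range (\<lambda>e. wlow $ e / w $ e)" unfolding M_def by (intro Max_in) auto
  then obtain e where e: "M = wlow $ e / w $ e" by auto
  have M_ub: "\<forall>\<omega>\<in>S. ?g \<omega> \<le> M"
    unfolding all_le using le_M w by (simp add: pos_divide_le_eq mult.commute)
  \<comment> \<open>A maximizer for the edge with the largest ratio already reaches the upper bound
    \<open>M\<close>.\<close>
  obtain \<omega> where \<omega>: "\<omega> \<in> S" "\<bar>Q \<omega> $ e\<bar> = wlow $ e" using low unfolding is_maximum_def by blast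
  have "wlow $ e \<le> w $ e * ?g \<omega>" using iffD1[OF g_le order_refl, rule_format, of \<omega> e] \<omega>(2) by simp
  then have "M \<le> ?g \<omega>" using w[of e] by (simp add: e pos_divide_le_eq mult.commute)
  then have "?g \<omega> = M" using M_ub \<omega>(1) by (simp add: order_antisym)
  then have max: "is_maximum ?g S M" unfolding is_maximum_def using M_ub \<omega>(1) by blast
  show ?thesis
  proof
    assume ?L
    then obtain N where "\<forall>\<omega>\<in>S. ?g \<omega> \<le> N" "N \<le> r" unfolding is_maximum_def by blast
    then have "\<forall>\<omega>\<in>S. ?g \<omega> \<le> r" by (blast intro: order_trans)
    then show ?R unfolding all_le .
  next
    assume ?R
    then have "\<forall>\<omega>\<in>S. ?g \<omega> \<le> r" unfolding all_le .
    then have "?g \<omega> \<le> r" using \<omega>(1) by blast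
    with \<open>?g \<omega> = M\<close> max show ?L by auto
  qed
qed

text \<open>For \<open>s = 0\<close> both sides are false: the left one demands infinity at most
  \<open>b\<close>, the right one \<open>a \<le> 0\<close>.\<close>

lemma ereal_threshold_iff:
  assumes "0 < a" "0 \<le> s"
  shows "ereal a * inverse (ereal s) \<le> ereal b \<longleftrightarrow> a \<le> b * s"
  using assms by (cases "s = 0") (auto simp: field_simps)

theorem proposition2:
  fixes E :: "'n::finite set set"
    and ends :: "'m::finite \<Rightarrow> 'n set"
    and B :: "real^'m^'n"
    and C :: "real^'n^'p" and d :: "real^'p"
    and f :: "real^'m \<Rightarrow> real"
    and F :: "(real^'m) set"
    and \<gamma> :: real
    and wlow :: "real^'m"
  assumes "tree_graph E"
    and "bij_betw ends UNIV E"
    and "CARD('m) = CARD('n) - 1"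
    and "incidence_matrix ends B"
    and "convex_on {w. \<forall>e. 0 \<le> w $ e} f"
    and "F \<subseteq> {w. \<forall>e. 0 \<le> w $ e}"
    and "closed F"
    and "convex F"
    and "\<And>w. w \<in> F \<Longrightarrow> lambda2 (weighted_laplacian B w) > 0"
    and "0 \<le> \<gamma>" and "\<gamma> < pi / 2"
    and "\<And>e. is_maximum
               (\<lambda>\<omega>. \<bar>axis e 1 \<bullet> ((transpose B ** pinv (B ** transpose B)) *v \<omega>)\<bar>)
               (polyhedron_of C d) (wlow $ e)"
    and "\<And>e. 0 < wlow $ e"
  shows "robust_feasible B (polyhedron_of C d) F \<gamma> = threshold_feasible wlow F \<gamma>
       \<and> minimizers f (robust_feasible B (polyhedron_of C d) F \<gamma>)
           = minimizers f (threshold_feasible wlow F \<gamma>)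
       \<and> optimal_value f (robust_feasible B (polyhedron_of C d) F \<gamma>)
           = optimal_value f (threshold_feasible wlow F \<gamma>)
       \<and> convex (threshold_feasible wlow F \<gamma>)
       \<and> convex_on (threshold_feasible wlow F \<gamma>) f"
proof -
  let ?\<Omega> = "polyhedron_of C d"
  have range: "range ends = E" using assms(2) by (simp add: bij_betw_def)
  have "connected_graph E" using assms(1) by (simp add: tree_graph_def)
  then obtain P where P: "P ** B = mat 1" "transpose (B ** P) = B ** P"
    using injective_symmetric_left_inverse incidence_injective assms(3,4) range by metis
  have nonneg: "0 \<le> w $ e" if "w \<in> F" for w e using that assms(6) by auto
  have pos: "0 < w $ e" if "w \<in> F" for w e
    using that nonneg assms(9) lambda2_laplacian_zero_weight[OF assms(3)]
    by (metis less_irrefl order_le_less)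
  \<comment> \<open>\<open>B ** transpose B\<close> is the Laplacian with unit weights.\<close>
  have "transpose B ** pinv (B ** transpose B) = P"
    using transpose_mul_pinv_laplacian[OF P, of "\<chi> e. 1"]
    by (simp add: diag_matrix_1 weighted_laplacian_def)
  then have low: "is_maximum (\<lambda>\<omega>. \<bar>(P *v \<omega>) $ e\<bar>) ?\<Omega> (wlow $ e)" for e
    using assms(12)[of e] by (simp add: inner_axis')
  have sin: "0 \<le> sin \<gamma>" using assms(10,11) by (simp add: sin_ge_zero)
  have thr: "threshold_feasible wlow F \<gamma> = F \<inter> {w. \<forall>e. wlow $ e \<le> w $ e * sin \<gamma>}"
    using ereal_threshold_iff[OF assms(13) sin] by (auto simp: threshold_feasible_def)
  have rob: "(\<exists>M. is_maximum
        (\<lambda>\<omega>. infnorm ((transpose B ** pinv (weighted_laplacian B w)) *v \<omega>)) ?\<Omega> M \<and> M \<le> sin \<gamma>)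
      \<longleftrightarrow> (\<forall>e. wlow $ e \<le> w $ e * sin \<gamma>)" if "w \<in> F" for w
  proof -
    have "(transpose B ** pinv (weighted_laplacian B w)) *v \<omega>
        = (\<chi> e. inverse (w $ e) * (P *v \<omega>) $ e)" for \<omega>
      using transpose_mul_pinv_laplacian[OF P, of w] pos[OF that]
      by (simp add: less_imp_neq[symmetric] diag_matrix_mul_vec flip: matrix_vector_mul_assoc)
    then show ?thesis using robust_max_le_iff[OF pos[OF that] low] by simp
  qed
  \<comment> \<open>Equality of the feasible sets settles minimizers and optimal values at once,
    including the infeasible case.\<close>
  have eq: "robust_feasible B ?\<Omega> F \<gamma> = threshold_feasible wlow F \<gamma>"
    unfolding thr robust_feasible_def using rob by blast
  have "convex {w :: real^'m. \<forall>e. wlow $ e \<le> w $ e * sin \<gamma>}"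
  proof -
    have "{w :: real^'m. \<forall>e. wlow $ e \<le> w $ e * sin \<gamma>}
        = (\<Inter>e. {w. axis e (sin \<gamma>) \<bullet> w \<ge> wlow $ e})"
      by (auto simp: inner_axis' mult.commute)
    then show ?thesis by (simp add: convex_INT convex_halfspace_ge)
  qed
  then have conv: "convex (threshold_feasible wlow F \<gamma>)"
    unfolding thr using assms(8) by (intro convex_Int)
  have "threshold_feasible wlow F \<gamma> \<subseteq> {w. \<forall>e. 0 \<le> w $ e}"
    using assms(6) by (auto simp: threshold_feasible_def)
  then have "convex_on (threshold_feasible wlow F \<gamma>) f"
    using convex_on_subset assms(5) conv by blast
  with eq conv show ?thesis by simp
qed

end
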